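(* For each regular cardinal $\kappa$, there is a ccc compact $T_1$ space $X$ of cardinality $\kappa$ such that no uncountable subspace $Y\subseteq X$ with $|Y|<\kappa$ is ccc (in the subspace topology).
   Context: A topological space $(X,\tau)$ is ccc (has the countable chain condition) if for any uncountable $\mathcal{F}\subseteq\tau$ there are distinct $U,V\in\mathcal{F}$ with $U\cap V\neq\emptyset$. Regular cardinals are infinite by convention. Compact means that every open cover has a finite subcover (no separation axiom is implied). *)

theory Defs
  imports "HOL-Analysis.Analysis"
begin

unbundle cardinal_syntax

definition ccc_space :: "'a topology \<Rightarrow> bool" where
  "ccc_space X \<longleftrightarrow>
     (\<forall>\<F>. (\<forall>U\<in>\<F>. openin X U) \<and> uncountable \<F> \<longrightarrow>
        (\<exists>U\<in>\<F>. \<exists>V\<in>\<F>. U \<noteq> V \<and> U \<inter> V \<noteq> {}))"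

end

theory Submission
  imports Defs
begin

text \<open>
  Let \<open>S\<close> be a set of cardinality \<open>\<kappa>\<close>. In the co-\<open><\<kappa>\<close> topology on \<open>S\<close> any two nonempty open
  sets meet, because two complements of size less than \<open>\<kappa>\<close> cannot cover \<open>S\<close>; yet every subspace
  \<open>Y\<close> with \<open>|Y| < \<kappa>\<close> is discrete, because \<open>{y} \<union> (S - Y)\<close> is an open set that meets \<open>Y\<close> only
  in \<open>y\<close>. This space is \<open>T\<^sub>1\<close> and ccc and has no uncountable ccc subspace of size less than
  \<open>\<kappa>\<close>, but it is not compact when \<open>\<kappa>\<close> is uncountable.

  Compactness is gained by adding a point \<open>p\<close> whose open neighbourhoods are the cofinite sets: the
  member of a cover that contains \<open>p\<close> leaves only finitely many points. A single point
  does not affect the other properties: cofinite sets still meet all nonempty open sets, and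
  \<open>Y - {p}\<close> remains a discrete open subspace of \<open>Y\<close>, uncountable if \<open>Y\<close> is. As \<open>\<kappa>\<close> is
  infinite, \<open>p\<close> can be taken from \<open>S\<close> itself.
\<close>

text \<open>
  For uncountable \<open>S\<close> this is the one-point compactification of the co-\<open><|S|\<close> topology on
  \<open>S - {p}\<close>, with \<open>p\<close> as the point at infinity: the compact sets of the latter are the finite
  ones. For countably infinite \<open>S\<close> it is the cofinite topology.
\<close>

definition small_complement_open :: "'a set \<Rightarrow> 'a \<Rightarrow> 'a set \<Rightarrow> bool" where
  "small_complement_open S p U \<longleftrightarrow>
     U \<subseteq> S \<and> (U \<noteq> {} \<longrightarrow> |S - U| <o |S| \<and> (p \<in> U \<longrightarrow> finite (S - U)))"

definition small_complement_topology :: "'a set \<Rightarrow> 'a \<Rightarrow> 'a topology" where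
  "small_complement_topology S p = topology (small_complement_open S p)"

lemma istopology_small_complement:
  assumes "infinite S"
  shows "istopology (small_complement_open S p)"
  unfolding istopology_def
proof (intro conjI allI impI)
  fix U V
  assume U: "small_complement_open S p U" and V: "small_complement_open S p V"
  have eq: "S - U \<inter> V = (S - U) \<union> (S - V)"
    by blast
  have "|(S - U) \<union> (S - V)| <o |S|" if "|S - U| <o |S|" "|S - V| <o |S|"
    using card_of_Un_ordLess_infinite[OF assms that] .
  with U V show "small_complement_open S p (U \<inter> V)"
    unfolding small_complement_open_def eq by auto
next
  fix \<K>
  assume *: "\<forall>U\<in>\<K>. small_complement_open S p U"
  show "small_complement_open S p (\<Union>\<K>)"
    unfolding small_complement_open_def
  proof (intro conjI impI)
    show "\<Union>\<K> \<subseteq> S"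
      using * unfolding small_complement_open_def by blast
  next
    assume "\<Union>\<K> \<noteq> {}"
    then obtain U where U: "U \<in> \<K>" "U \<noteq> {}"
      by blast
    then have "|S - U| <o |S|"
      using * unfolding small_complement_open_def by blast
    moreover have "|S - \<Union>\<K>| \<le>o |S - U|"
      using U by (intro card_of_mono1) blast
    ultimately show "|S - \<Union>\<K>| <o |S|"
      using ordLeq_ordLess_trans by blast
  next
    assume "p \<in> \<Union>\<K>"
    then obtain U where U: "U \<in> \<K>" "p \<in> U"
      by blast
    then have "finite (S - U)"
      using * unfolding small_complement_open_def by blast
    then show "finite (S - \<Union>\<K>)"
      by (rule rev_finite_subset) (use U in blast)
  qed
qed

lemma openin_small_complement:
  assumes "infinite S"
  shows "openin (small_complement_topology S p) U \<longleftrightarrow> small_complement_open S p U"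
  by (simp add: small_complement_topology_def istopology_small_complement[OF assms]
      topology_inverse')

lemma finite_ordLess_infinite_set:
  assumes "infinite S" "finite A"
  shows "|A| <o |S|"
  using finite_ordLess_infinite[OF card_of_Well_order card_of_Well_order, of A S] assms
  by (simp add: Field_card_of)

lemma openin_small_complement_cofinite:
  assumes "infinite S" "U \<subseteq> S" "finite (S - U)"
  shows "openin (small_complement_topology S p) U"
  using assms finite_ordLess_infinite_set
  by (auto simp: openin_small_complement small_complement_open_def)

lemma topspace_small_complement:
  assumes "infinite S"
  shows "topspace (small_complement_topology S p) = S"
proof
  show "topspace (small_complement_topology S p) \<subseteq> S"
    using openin_topspace[of "small_complement_topology S p"]
    unfolding openin_small_complement[OF assms] small_complement_open_def by blast
  show "S \<subseteq> topspace (small_complement_topology S p)"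
    by (intro openin_subset openin_small_complement_cofinite) (use assms in auto)
qed

lemma t1_space_small_complement:
  assumes "infinite S"
  shows "t1_space (small_complement_topology S p)"
  unfolding t1_space_closedin_singleton topspace_small_complement[OF assms] closedin_def
  by (auto intro!: openin_small_complement_cofinite[OF assms] simp: Diff_Diff_Int)

lemma compact_space_small_complement:
  assumes S: "infinite S" and "p \<in> S"
  shows "compact_space (small_complement_topology S p)"
  unfolding compact_space_alt topspace_small_complement[OF S]
proof (intro allI impI, elim conjE)
  fix \<U>
  assume op: "Ball \<U> (openin (small_complement_topology S p))" and cov: "S \<subseteq> \<Union>\<U>"
  obtain U where U: "U \<in> \<U>" "p \<in> U"
    using cov \<open>p \<in> S\<close> by blast
  then have "finite (S - U)"
    using op by (auto simp: openin_small_complement[OF S] small_complement_open_def)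
  moreover have "S - U \<subseteq> \<Union>\<U>"
    using cov by blast
  ultimately obtain \<F> where "finite \<F>" "\<F> \<subseteq> \<U>" "S - U \<subseteq> \<Union>\<F>"
    using finite_subset_Union by metis
  then show "\<exists>\<F>. finite \<F> \<and> \<F> \<subseteq> \<U> \<and> S \<subseteq> \<Union>\<F>"
    using U by (intro exI[of _ "insert U \<F>"]) auto
qed

lemma ccc_space_if_open_sets_meet:
  assumes "\<And>U V. openin X U \<Longrightarrow> openin X V \<Longrightarrow> U \<noteq> {} \<Longrightarrow> V \<noteq> {} \<Longrightarrow> U \<inter> V \<noteq> {}"
  shows "ccc_space X"
  unfolding ccc_space_def
proof (intro allI impI, elim conjE)
  fix \<F>
  assume op: "\<forall>U\<in>\<F>. openin X U" and "uncountable \<F>"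
  then have "infinite (\<F> - {{}})"
    using countable_finite[of \<F>] by auto
  then obtain U where U: "U \<in> \<F> - {{}}"
    by (metis ex_in_conv finite.emptyI)
  obtain V where V: "V \<in> \<F> - {{}} - {U}"
    using \<open>infinite (\<F> - {{}})\<close> by (metis ex_in_conv finite.emptyI infinite_remove)
  have "U \<inter> V \<noteq> {}"
    using U V op by (intro assms) auto
  with U V show "\<exists>U\<in>\<F>. \<exists>V\<in>\<F>. U \<noteq> V \<and> U \<inter> V \<noteq> {}"
    by blast
qed

lemma ccc_space_small_complement:
  assumes S: "infinite S"
  shows "ccc_space (small_complement_topology S p)"
proof (rule ccc_space_if_open_sets_meet)
  fix U V
  assume "openin (small_complement_topology S p) U" "openin (small_complement_topology S p) V"
    and "U \<noteq> {}" "V \<noteq> {}"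
  then have "|S - U| <o |S|" "|S - V| <o |S|"
    by (auto simp: openin_small_complement[OF S] small_complement_open_def)
  then have "|(S - U) \<union> (S - V)| <o |S|"
    by (rule card_of_Un_ordLess_infinite[OF S])
  then have "(S - U) \<union> (S - V) \<noteq> S"
    using ordLess_irreflexive[of "|S|"] by auto
  then show "U \<inter> V \<noteq> {}"
    by blast
qed

lemma not_ccc_space_if_uncountably_many_open_points:
  assumes "uncountable D" and "\<And>y. y \<in> D \<Longrightarrow> openin X {y}"
  shows "\<not> ccc_space X"
proof
  assume ccc: "ccc_space X"
  have "uncountable ((\<lambda>y. {y}) ` D)"
    using assms(1) by (simp add: countable_image_inj_eq)
  moreover have "\<forall>U\<in>(\<lambda>y. {y}) ` D. openin X U"
    using assms(2) by simp
  ultimately obtain U V where "U \<in> (\<lambda>y. {y}) ` D" "V \<in> (\<lambda>y. {y}) ` D" "U \<noteq> V" "U \<inter> V \<noteq> {}"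
    using ccc[unfolded ccc_space_def, rule_format, of "(\<lambda>y. {y}) ` D"] by metis
  then show False
    by auto
qed

lemma not_ccc_space_small_subspace:
  assumes S: "infinite S" and "Y \<subseteq> S" "uncountable Y" "|Y| <o |S|"
  shows "\<not> ccc_space (subtopology (small_complement_topology S p) Y)"
proof (rule not_ccc_space_if_uncountably_many_open_points)
  show "uncountable (Y - {p})"
    using \<open>uncountable Y\<close> by (simp add: uncountable_minus_countable)
next
  fix y
  assume y: "y \<in> Y - {p}"
  \<comment> \<open>Without \<open>p\<close>, \<open>U\<close> only has to be the complement of a small set, not of a finite one.\<close>
  define U where "U = insert y (S - Y - {p})"
  have "S - U \<subseteq> Y \<union> {p}"
    unfolding U_def by blast
  moreover have "|Y \<union> {p}| <o |S|"
    by (intro card_of_Un_ordLess_infinite finite_ordLess_infinite_set S \<open>|Y| <o |S|\<close>) simp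
  ultimately have "|S - U| <o |S|"
    by (rule ordLeq_ordLess_trans[OF card_of_mono1])
  then have "openin (small_complement_topology S p) U"
    using y \<open>Y \<subseteq> S\<close> unfolding U_def
    by (auto simp: openin_small_complement[OF S] small_complement_open_def)
  moreover have "{y} = U \<inter> Y"
    using y unfolding U_def by blast
  ultimately show "openin (subtopology (small_complement_topology S p) Y) {y}"
    unfolding openin_subtopology by (intro exI[of _ U] conjI)
qed

theorem mainTheorem4:
  fixes \<kappa> :: "'k rel"
  assumes "Cinfinite \<kappa>" and "regularCard \<kappa>"
  shows "\<exists>X :: 'k topology.
           ccc_space X \<and> compact_space X \<and> t1_space X \<and> |topspace X| =o \<kappa> \<and>
           (\<forall>Y. Y \<subseteq> topspace X \<and> uncountable Y \<and> |Y| <o \<kappa> \<longrightarrow>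
                \<not> ccc_space (subtopology X Y))"
proof -
  define S where "S = Field \<kappa>"
  have S: "infinite S"
    using assms(1) unfolding S_def cinfinite_def by (rule conjunct1)
  have card: "|S| =o \<kappa>"
    using assms(1) unfolding S_def by (intro card_of_Field_ordIso) (rule conjunct2)
  obtain p where p: "p \<in> S"
    using S by (metis ex_in_conv finite.emptyI)
  have "\<not> ccc_space (subtopology (small_complement_topology S p) Y)"
    if "Y \<subseteq> S" "uncountable Y" "|Y| <o \<kappa>" for Y
    using that
    by (intro not_ccc_space_small_subspace S ordLess_ordIso_trans[OF _ ordIso_symmetric[OF card]])
  then have "\<forall>Y. Y \<subseteq> S \<and> uncountable Y \<and> |Y| <o \<kappa> \<longrightarrow>
      \<not> ccc_space (subtopology (small_complement_topology S p) Y)"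
    by blast
  with ccc_space_small_complement[OF S] compact_space_small_complement[OF S p]
    t1_space_small_complement[OF S] card
  show ?thesis
    by (intro exI[of _ "small_complement_topology S p"] conjI)
       (simp_all only: topspace_small_complement[OF S])
qed

end
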